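(* Let $m\ge1$, $p=4m$, and let $\Lambda=(\lambda_1,\ldots,\lambda_n)\subset\mathbb{R}^p$ be an admissible configuration whose affine span is $\mathbb{R}^p$. Every orbit of the $\mathbb{R}^p$-action $\Phi$ in $\mathcal{S}_\Lambda$ contains a unique point of minimum Euclidean norm. At this minimum $q$ one has $$\sum_i\lambda_i|q_i|^2=0.$$ Moreover, the map $$Z_{\mathbb H}(\Lambda)\times\mathbb{R}^p\times\mathbb{R}_{>0}\longrightarrow\mathcal{S}_\Lambda,\qquad (q,T,r)\longmapsto r\,\Phi_T(q),$$ is a diffeomorphism.
   Context: $\mathbb{H}$ denotes the quaternions. A configuration $\Lambda=(\lambda_1,\ldots,\lambda_n)\subset\mathbb{R}^p$ is admissible if $0\in\operatorname{conv}\{\lambda_1,\ldots,\lambda_n\}$ and, for every $I\subset\{1,\ldots,n\}$, $0\in\operatorname{conv}\{\lambda_i:i\in I\}$ implies $|I|>p$. Define the open set $$\mathcal{S}_\Lambda=\{q\in\mathbb{H}^n:\ 0\in\operatorname{conv}\{\lambda_i:q_i\ne0\}\},$$ the action of $T\in\mathbb{R}^p$ $$\Phi_T(q_1,\ldots,q_n)=\big(e^{\langle\lambda_1,T\rangle}q_1,\ldots,e^{\langle\lambda_n,T\rangle}q_n\big),$$ where $\langle\cdot,\cdot\rangle$ is the Euclidean inner product, and $$Z_{\mathbb H}(\Lambda)=\Big\{q\in\mathbb{H}^n:\ \sum_i\lambda_i|q_i|^2=0,\ \sum_i|q_i|^2=1\Big\},$$ which is a compact smooth submanifold of $\mathbb{H}^n$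 under these assumptions. *)

theory Defs
  imports "HOL-Analysis.Analysis"
begin

section \<open>Quaternions\<close>

datatype quat = Quat (qre: real) (qim1: real) (qim2: real) (qim3: real)

lemma quat_eq_iff:
  "x = y \<longleftrightarrow> qre x = qre y \<and> qim1 x = qim1 y \<and> qim2 x = qim2 y \<and> qim3 x = qim3 y"
  by (cases x; cases y) simp

instantiation quat :: ab_group_add
begin

definition "0 = Quat 0 0 0 0"
definition "x + y = Quat (qre x + qre y) (qim1 x + qim1 y) (qim2 x + qim2 y) (qim3 x + qim3 y)"
definition "- x = Quat (- qre x) (- qim1 x) (- qim2 x) (- qim3 x)"
definition "x - y = Quat (qre x - qre y) (qim1 x - qim1 y) (qim2 x - qim2 y) (qim3 x - qim3 y)"

instance
  by standard
    (simp_all add: quat_eq_iff zero_quat_def plus_quat_def uminus_quat_def minus_quat_def)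

end

lemma quat_add_sels [simp]:
  "qre 0 = 0" "qim1 0 = 0" "qim2 0 = 0" "qim3 0 = 0"
  "qre (x + y) = qre x + qre y" "qim1 (x + y) = qim1 x + qim1 y"
  "qim2 (x + y) = qim2 x + qim2 y" "qim3 (x + y) = qim3 x + qim3 y"
  "qre (- x) = - qre x" "qim1 (- x) = - qim1 x"
  "qim2 (- x) = - qim2 x" "qim3 (- x) = - qim3 x"
  "qre (x - y) = qre x - qre y" "qim1 (x - y) = qim1 x - qim1 y"
  "qim2 (x - y) = qim2 x - qim2 y" "qim3 (x - y) = qim3 x - qim3 y"
  by (simp_all add: zero_quat_def plus_quat_def uminus_quat_def minus_quat_def)

instantiation quat :: real_algebra_1
begin

definition "1 = Quat 1 0 0 0"

definition "x * y = Quat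
  (qre x * qre y - qim1 x * qim1 y - qim2 x * qim2 y - qim3 x * qim3 y)
  (qre x * qim1 y + qim1 x * qre y + qim2 x * qim3 y - qim3 x * qim2 y)
  (qre x * qim2 y - qim1 x * qim3 y + qim2 x * qre y + qim3 x * qim1 y)
  (qre x * qim3 y + qim1 x * qim2 y - qim2 x * qim1 y + qim3 x * qre y)"

definition "r *\<^sub>R x = Quat (r * qre x) (r * qim1 x) (r * qim2 x) (r * qim3 x)"

instance
  by standard
    (simp_all add: quat_eq_iff one_quat_def times_quat_def scaleR_quat_def algebra_simps)

end

lemma quat_mult_sels [simp]:
  "qre 1 = 1" "qim1 1 = 0" "qim2 1 = 0" "qim3 1 = 0"
  "qre (x * y) = qre x * qre y - qim1 x * qim1 y - qim2 x * qim2 y - qim3 x * qim3 y"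
  "qim1 (x * y) = qre x * qim1 y + qim1 x * qre y + qim2 x * qim3 y - qim3 x * qim2 y"
  "qim2 (x * y) = qre x * qim2 y - qim1 x * qim3 y + qim2 x * qre y + qim3 x * qim1 y"
  "qim3 (x * y) = qre x * qim3 y + qim1 x * qim2 y - qim2 x * qim1 y + qim3 x * qre y"
  "qre (r *\<^sub>R x) = r * qre x" "qim1 (r *\<^sub>R x) = r * qim1 x"
  "qim2 (r *\<^sub>R x) = r * qim2 x" "qim3 (r *\<^sub>R x) = r * qim3 x"
  by (simp_all add: one_quat_def times_quat_def scaleR_quat_def)

lemma quat_sum_squares_eq_0_iff:
  "(qre x)\<^sup>2 + (qim1 x)\<^sup>2 + (qim2 x)\<^sup>2 + (qim3 x)\<^sup>2 = 0 \<longleftrightarrow> x = 0"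
  by (simp add: quat_eq_iff add_nonneg_eq_0_iff)

instantiation quat :: real_inner
begin

definition "inner x y = qre x * qre y + qim1 x * qim1 y + qim2 x * qim2 y + qim3 x * qim3 y"
definition "norm x = sqrt ((qre x)\<^sup>2 + (qim1 x)\<^sup>2 + (qim2 x)\<^sup>2 + (qim3 x)\<^sup>2)"
definition "sgn x = x /\<^sub>R norm x" for x :: quat
definition "dist x y = norm (x - y)" for x y :: quat
definition
  "(uniformity :: (quat \<times> quat) filter) = (INF e\<in>{0<..}. principal {(x, y). dist x y < e})"
definition
  "open (U :: quat set) \<longleftrightarrow> (\<forall>x\<in>U. eventually (\<lambda>(x', y). x' = x \<longrightarrow> y \<in> U) uniformity)"

instance
proof
  fix x :: quat
  have "inner x x = (qre x)\<^sup>2 + (qim1 x)\<^sup>2 + (qim2 x)\<^sup>2 + (qim3 x)\<^sup>2"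
    by (simp add: inner_quat_def power2_eq_square)
  then show "0 \<le> inner x x" "inner x x = 0 \<longleftrightarrow> x = 0" "norm x = sqrt (inner x x)"
    by (simp_all add: quat_sum_squares_eq_0_iff norm_quat_def)
qed (simp_all add: sgn_quat_def dist_quat_def uniformity_quat_def open_quat_def
      inner_quat_def algebra_simps)

end

instantiation quat :: euclidean_space
begin

definition "Basis = {Quat 1 0 0 0, Quat 0 1 0 0, Quat 0 0 1 0, Quat 0 0 0 1}"

instance
proof
  show "(Basis :: quat set) \<noteq> {}" "finite (Basis :: quat set)"
    by (simp_all add: Basis_quat_def)
  show "inner u v = (if u = v then 1 else 0)" if "u \<in> Basis" "v \<in> Basis" for u v :: quat
    using that unfolding Basis_quat_def
    by (elim insertE emptyE; hypsubst; simp add: inner_quat_def)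
  show "(\<forall>u\<in>Basis. inner x u = 0) \<longleftrightarrow> x = 0" for x :: quat
    by (cases x) (simp add: Basis_quat_def inner_quat_def zero_quat_def)
qed

end

instantiation quat :: real_normed_div_algebra
begin

definition "inverse x = Quat (qre x) (- qim1 x) (- qim2 x) (- qim3 x) /\<^sub>R (norm x)\<^sup>2"
definition "x div y = x * inverse y" for x y :: quat

instance
proof
  fix x y :: quat
  let ?N = "(norm x)\<^sup>2" and ?c = "Quat (qre x) (- qim1 x) (- qim2 x) (- qim3 x)"
  have N: "?N = (qre x)\<^sup>2 + (qim1 x)\<^sup>2 + (qim2 x)\<^sup>2 + (qim3 x)\<^sup>2"
    by (simp add: norm_quat_def)
  have c: "?c * x = ?N *\<^sub>R 1" "x * ?c = ?N *\<^sub>R 1"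
    unfolding N by (simp_all add: quat_eq_iff power2_eq_square)
  show "inverse x * x = 1" "x * inverse x = 1" if "x \<noteq> 0"
    using that by (simp_all add: inverse_quat_def c)
  show "inverse (0 :: quat) = 0"
    by (simp add: inverse_quat_def)
  show "x div y = x * inverse y"
    by (rule divide_quat_def)
  have "(a * a' - b * b' - c * c' - d * d')\<^sup>2 + (a * b' + b * a' + c * d' - d * c')\<^sup>2 +
      (a * c' - b * d' + c * a' + d * b')\<^sup>2 + (a * d' + b * c' - c * b' + d * a')\<^sup>2 =
      (a\<^sup>2 + b\<^sup>2 + c\<^sup>2 + d\<^sup>2) * (a'\<^sup>2 + b'\<^sup>2 + c'\<^sup>2 + d'\<^sup>2)"
    for a b c d a' b' c' d' :: real
    by algebra
  then show "norm (x * y) = norm x * norm y"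
    by (simp only: norm_quat_def quat_mult_sels real_sqrt_mult)
qed

end

section \<open>Smooth maps and diffeomorphisms between subsets of Euclidean spaces\<close>

text \<open>On an open set \<open>U\<close> of a Euclidean space, \<open>C_k_on k f U\<close> says that \<open>f\<close> is
  \<open>k\<close> times continuously differentiable: all iterated directional derivatives up to order \<open>k\<close>
  exist and are continuous. It is only meant to be used for open \<open>U\<close>.\<close>

fun C_k_on :: "nat \<Rightarrow> ('a::euclidean_space \<Rightarrow> 'b::euclidean_space) \<Rightarrow> 'a set \<Rightarrow> bool" where
  "C_k_on 0 f U \<longleftrightarrow> continuous_on U f"
| "C_k_on (Suc k) f U \<longleftrightarrow>
     (\<forall>x\<in>U. f differentiable (at x)) \<and>
     (\<forall>v. C_k_on k (\<lambda>x. frechet_derivative f (at x) v) U)"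

text \<open>A map on an arbitrary subset of a Euclidean space is smooth if, near each point of the subset,
  it extends to a smooth map on an open set of the ambient space. On embedded submanifolds this
  agrees with smoothness for the submanifold structure.\<close>

definition smooth_map_on ::
  "('a::euclidean_space \<Rightarrow> 'b::euclidean_space) \<Rightarrow> 'a set \<Rightarrow> bool" where
  "smooth_map_on f S \<longleftrightarrow>
     (\<forall>x\<in>S. \<exists>U g. open U \<and> x \<in> U \<and> (\<forall>k. C_k_on k g U) \<and> (\<forall>y\<in>S \<inter> U. g y = f y))"

definition diffeomorphism_on ::
  "('a::euclidean_space \<Rightarrow> 'b::euclidean_space) \<Rightarrow> 'a set \<Rightarrow> 'b set \<Rightarrow> bool" where
  "diffeomorphism_on f A B \<longleftrightarrow>
     bij_betw f A B \<and> smooth_map_on f A \<and> smooth_map_on (inv_into A f) B"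

section \<open>Configurations\<close>

text \<open>The index set \<open>{1,\<dots>,n}\<close> is the finite type \<open>'n\<close>, and \<open>p = CARD('p)\<close>.
  In the second condition \<open>I\<close> is a set of indices, so repeated vectors count separately.\<close>

definition admissible_config :: "('n::finite \<Rightarrow> real ^ 'p::finite) \<Rightarrow> bool" where
  "admissible_config \<Lambda> \<longleftrightarrow>
     0 \<in> convex hull (range \<Lambda>) \<and>
     (\<forall>I. 0 \<in> convex hull (\<Lambda> ` I) \<longrightarrow> card I > CARD('p))"

definition S_set :: "('n::finite \<Rightarrow> real ^ 'p::finite) \<Rightarrow> (quat ^ 'n) set" where
  "S_set \<Lambda> = {q. 0 \<in> convex hull (\<Lambda> ` {i. q $ i \<noteq> 0})}"

definition Phi :: "('n::finite \<Rightarrow> real ^ 'p::finite) \<Rightarrow> real ^ 'p \<Rightarrow> quat ^ 'n \<Rightarrow> quat ^ 'n" where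
  "Phi \<Lambda> T q = (\<chi> i. exp (\<Lambda> i \<bullet> T) *\<^sub>R q $ i)"

definition Phi_orbit :: "('n::finite \<Rightarrow> real ^ 'p::finite) \<Rightarrow> quat ^ 'n \<Rightarrow> (quat ^ 'n) set" where
  "Phi_orbit \<Lambda> q = range (\<lambda>T. Phi \<Lambda> T q)"

definition Z_set :: "('n::finite \<Rightarrow> real ^ 'p::finite) \<Rightarrow> (quat ^ 'n) set" where
  "Z_set \<Lambda> = {q. (\<Sum>i\<in>UNIV. (norm (q $ i))\<^sup>2 *\<^sub>R \<Lambda> i) = 0 \<and> (\<Sum>i\<in>UNIV. (norm (q $ i))\<^sup>2) = 1}"

end

theory Submission
  imports Defs
begin

text \<open>The squared norm on the orbit of \<open>q\<close> is \<open>T \<mapsto> \<Sum>i. exp (2 \<langle>\<lambda>\<^sub>i, T\<rangle>) |q\<^sub>i|\<^sup>2\<close>. By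
  Caratheodory's theorem, admissibility and \<open>q \<in> S_set \<Lambda>\<close> imply that every nonzero \<open>T\<close>
  has a positive inner product with some \<open>\<lambda>\<^sub>i\<close> with \<open>q\<^sub>i \<noteq> 0\<close>; hence this function is coercive and
  strictly convex, and has a unique critical point \<open>\<tau> q\<close>, at which \<open>\<Sum>i. exp (2 \<langle>\<lambda>\<^sub>i, T\<rangle>) |q\<^sub>i|\<^sup>2 \<lambda>\<^sub>i = 0\<close>.
  The inverse of the map in the theorem normalizes the point of the orbit with parameter \<open>\<tau> q\<close>, so it
  is smooth because \<open>\<tau>\<close> is. The differentiability of \<open>\<tau>\<close> comes from invariance of domain and the
  inverse function rule; smoothness follows by induction on the order, since the derivative of \<open>\<tau>\<close>
  solves a linear system whose coefficients are smooth functions of \<open>q\<close> and \<open>\<tau> q\<close>.\<close>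

section \<open>Calculus of k times continuously differentiable maps\<close>

text \<open>Since \<open>U\<close> is open, the derivative at a point of \<open>U\<close> depends
  only on values in \<open>U\<close>, so \<open>f\<close> and \<open>g\<close> share their
  derivatives there and the induction passes to these.\<close>

lemma C_k_on_cong:
  assumes "open U" and "\<And>x. x \<in> U \<Longrightarrow> f x = g x" and "C_k_on k f U"
  shows "C_k_on k g U"
  using assms(2,3)
proof (induction k arbitrary: f g)
  case 0
  have "continuous_on U f"
    using "0.prems"(2) by simp
  then have "continuous_on U g"
    by (rule continuous_on_eq) (rule "0.prems"(1))
  then show ?case
    by simp
next
  case (Suc k)
  have deriv: "(g has_derivative frechet_derivative f (at x)) (at x)" if "x \<in> U" for x
  proof (rule has_derivative_transform_within_open[OF _ assms(1) that])
    show "(f has_derivative frechet_derivative f (at x)) (at x)"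
      using Suc.prems(2) that by (simp add: frechet_derivative_works[symmetric])
  qed (rule Suc.prems(1))
  have "C_k_on k (\<lambda>x. frechet_derivative g (at x) v) U" for v
  proof (rule Suc.IH)
    show "frechet_derivative f (at x) v = frechet_derivative g (at x) v" if "x \<in> U" for x
      using frechet_derivative_at[OF deriv[OF that]] by (rule fun_cong)
    show "C_k_on k (\<lambda>x. frechet_derivative f (at x) v) U"
      using Suc.prems(2) by simp
  qed
  moreover have "g differentiable (at x)" if "x \<in> U" for x
    using deriv[OF that] by (rule differentiableI)
  ultimately show ?case
    by simp
qed

text \<open>Uniqueness of the derivative lets an explicit formula \<open>f'\<close> stand in for
  \<open>frechet_derivative\<close>, so that each rule below can start from the matching
  differentiation rule.\<close>

lemma C_k_on_derivI:
  assumes "open U" and deriv: "\<And>x. x \<in> U \<Longrightarrow> (f has_derivative f' x) (at x)"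
    and "\<And>v. C_k_on k (\<lambda>x. f' x v) U"
  shows "C_k_on (Suc k) f U"
proof -
  have "f' x v = frechet_derivative f (at x) v" if "x \<in> U" for x v
    using frechet_derivative_at[OF deriv[OF that]] by (rule fun_cong)
  from C_k_on_cong[OF assms(1) this assms(3)]
  have "C_k_on k (\<lambda>x. frechet_derivative f (at x) v) U" for v .
  moreover have "f differentiable (at x)" if "x \<in> U" for x
    using deriv[OF that] by (rule differentiableI)
  ultimately show ?thesis
    by simp
qed

lemma C_k_on_has_derivative:
  assumes "C_k_on (Suc k) f U" "x \<in> U"
  shows "(f has_derivative frechet_derivative f (at x)) (at x)"
  using assms by (simp only: frechet_derivative_works[symmetric] C_k_on.simps)

lemma C_k_on_frechet_derivative:
  "C_k_on (Suc k) f U \<Longrightarrow> C_k_on k (\<lambda>x. frechet_derivative f (at x) v) U"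
  by simp

lemma C_k_on_SucD:
  assumes "C_k_on (Suc k) f U"
  shows "C_k_on k f U"
  using assms
proof (induction k arbitrary: f)
  case 0
  then show ?case
    by (simp add: continuous_at_imp_continuous_on differentiable_imp_continuous_within)
next
  case (Suc k)
  then show ?case by simp
qed

lemma C_k_on_const: "open U \<Longrightarrow> C_k_on k (\<lambda>x. c) U"
proof (induction k arbitrary: c)
  case (Suc k)
  show ?case
    by (rule C_k_on_derivI[where f' = "\<lambda>_ _. 0"]) (use Suc in auto)
qed simp

lemma C_k_on_linear_compose:
  assumes "open U" "bounded_linear L" "C_k_on k f U"
  shows "C_k_on k (\<lambda>x. L (f x)) U"
  using assms(3)
proof (induction k arbitrary: f)
  case 0
  then show ?case
    using bounded_linear.continuous_on[OF assms(2)] by simp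
next
  case (Suc k)
  show ?case
    by (rule C_k_on_derivI[OF assms(1)
          bounded_linear.has_derivative[OF assms(2) C_k_on_has_derivative[OF Suc.prems]]])
      (assumption | intro Suc.IH C_k_on_frechet_derivative Suc.prems)+
qed

lemma C_k_on_id:
  assumes "open U" shows "C_k_on k (\<lambda>x. x) U"
proof (cases k)
  case (Suc j)
  show ?thesis unfolding Suc
    by (rule C_k_on_derivI[where f' = "\<lambda>_ v. v"]) (use assms C_k_on_const in auto)
qed simp

lemma C_k_on_linear: "open U \<Longrightarrow> bounded_linear L \<Longrightarrow> C_k_on k L U"
  by (rule C_k_on_linear_compose[OF _ _ C_k_on_id])

lemma C_k_on_vec_nth: "open U \<Longrightarrow> C_k_on k f U \<Longrightarrow> C_k_on k (\<lambda>x. f x $ i) U"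
  by (rule C_k_on_linear_compose[OF _ bounded_linear_vec_nth])

lemma C_k_on_add:
  assumes "open U" "C_k_on k f U" "C_k_on k g U"
  shows "C_k_on k (\<lambda>x. f x + g x) U"
  using assms(2,3)
proof (induction k arbitrary: f g)
  case 0
  then show ?case by (auto intro: continuous_on_add)
next
  case (Suc k)
  show ?case
    by (rule C_k_on_derivI[OF assms(1) has_derivative_add[OF
          C_k_on_has_derivative[OF Suc.prems(1)] C_k_on_has_derivative[OF Suc.prems(2)]]])
      (assumption | intro Suc.IH C_k_on_frechet_derivative Suc.prems)+
qed

lemma C_k_on_sum:
  assumes "open U" "\<And>i. i \<in> I \<Longrightarrow> C_k_on k (f i) U"
  shows "C_k_on k (\<lambda>x. \<Sum>i\<in>I. f i x) U"
  using assms(2)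
  by (induction I rule: infinite_finite_induct) (simp_all add: C_k_on_const C_k_on_add assms(1))

text \<open>The product rule leaves one factor undifferentiated in each summand, so the induction
  hypothesis is also applied to the factors themselves, at the order lowered by
  \<open>C_k_on_SucD\<close>.\<close>

lemma C_k_on_bilinear:
  assumes "bounded_bilinear B" "open U" "C_k_on k f U" "C_k_on k g U"
  shows "C_k_on k (\<lambda>x. B (f x) (g x)) U"
  using assms(3,4)
proof (induction k arbitrary: f g)
  case 0
  then show ?case by (auto intro: bounded_bilinear.continuous_on[OF assms(1)])
next
  case (Suc k)
  show ?case
    by (rule C_k_on_derivI[OF assms(2) bounded_bilinear.FDERIV[OF assms(1)
          C_k_on_has_derivative[OF Suc.prems(1)] C_k_on_has_derivative[OF Suc.prems(2)]]])
      (assumption | intro C_k_on_add Suc.IH C_k_on_frechet_derivative C_k_on_SucD[OF Suc.prems(1)]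
        C_k_on_SucD[OF Suc.prems(2)] Suc.prems assms(2))+
qed

lemmas C_k_on_mult = C_k_on_bilinear[OF bounded_bilinear_mult]
lemmas C_k_on_scaleR = C_k_on_bilinear[OF bounded_bilinear_scaleR]
lemmas C_k_on_inner = C_k_on_bilinear[OF bounded_bilinear_inner]

lemma C_k_on_prod:
  fixes f :: "'i \<Rightarrow> 'a::euclidean_space \<Rightarrow> real"
  assumes "open U" "\<And>i. i \<in> I \<Longrightarrow> C_k_on k (f i) U"
  shows "C_k_on k (\<lambda>x. \<Prod>i\<in>I. f i x) U"
  using assms(2)
  by (induction I rule: infinite_finite_induct) (simp_all add: C_k_on_const C_k_on_mult assms(1))

text \<open>A vector is the sum of its coordinates embedded along the axes, and these embeddings are
  linear.\<close>

lemma C_k_on_vec_lambda: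
  fixes f :: "'i::finite \<Rightarrow> 'a::euclidean_space \<Rightarrow> 'b::euclidean_space"
  assumes "open U" "\<And>i. C_k_on k (f i) U"
  shows "C_k_on k (\<lambda>x. \<chi> i. f i x) U"
proof -
  have "linear (axis i :: 'b \<Rightarrow> 'b ^ 'i)" for i
    by (auto intro!: linearI simp: axis_def vec_eq_iff)
  then have lin: "bounded_linear (axis i :: 'b \<Rightarrow> 'b ^ 'i)" for i
    by (simp only: linear_conv_bounded_linear)
  have "C_k_on k (\<lambda>x. \<Sum>i\<in>UNIV. axis i (f i x)) U"
    by (intro C_k_on_sum C_k_on_linear_compose[OF _ lin] assms)
  moreover have "(\<Sum>i\<in>UNIV. axis i (f i x)) = (\<chi> i. f i x)" for x
    by (simp add: vec_eq_iff axis_def if_distrib cong: if_cong)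
  ultimately show ?thesis by simp
qed

lemma C_k_on_Pair:
  assumes "open U" "C_k_on k f U" "C_k_on k g U"
  shows "C_k_on k (\<lambda>x. (f x, g x)) U"
proof -
  have "bounded_linear (\<lambda>y. (y, 0))" "bounded_linear (\<lambda>y. (0, y))"
    by (intro bounded_linear_Pair bounded_linear_ident bounded_linear_zero)+
  then have "C_k_on k (\<lambda>x. (f x, 0) + (0, g x)) U"
    by (intro C_k_on_add C_k_on_linear_compose[of U "\<lambda>y. (y, 0)"]
        C_k_on_linear_compose[of U "\<lambda>y. (0, y)"] assms)
  then show ?thesis by simp
qed

text \<open>The derivative contains \<open>exp (f x)\<close> again, needed at one order less, which
  the induction hypothesis supplies. The same self-reproduction drives \<open>C_k_on_inverse\<close>
  and \<open>C_k_on_sqrt\<close>.\<close>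

lemma C_k_on_exp:
  assumes "open U" "C_k_on k f U"
  shows "C_k_on k (\<lambda>x. exp (f x :: real)) U"
  using assms(2)
proof (induction k)
  case 0
  then show ?case by (auto intro: continuous_on_exp)
next
  case (Suc k)
  show ?case
    by (rule C_k_on_derivI[OF assms(1) has_derivative_exp[OF C_k_on_has_derivative[OF Suc.prems]]])
      (assumption | intro C_k_on_mult Suc.IH[OF C_k_on_SucD] C_k_on_frechet_derivative Suc.prems assms(1))+
qed

lemma C_k_on_inverse:
  fixes f :: "'a::euclidean_space \<Rightarrow> real"
  assumes "open U" "C_k_on k f U" "\<And>x. x \<in> U \<Longrightarrow> f x \<noteq> 0"
  shows "C_k_on k (\<lambda>x. inverse (f x)) U"
  using assms(2)
proof (induction k)
  case 0
  then show ?case using assms(3) by (auto intro: continuous_on_inverse)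
next
  case (Suc k)
  show ?case
    by (rule C_k_on_derivI[OF assms(1) Deriv.has_derivative_inverse[OF _
            C_k_on_has_derivative[OF Suc.prems]]])
      (assumption | intro assms(3) C_k_on_mult Suc.IH[OF C_k_on_SucD] C_k_on_frechet_derivative Suc.prems
          C_k_on_linear_compose[OF _ bounded_linear_minus[OF bounded_linear_ident]] assms(1))+
qed

lemma C_k_on_sqrt:
  assumes "open U" "C_k_on k f U" and pos: "\<And>x. x \<in> U \<Longrightarrow> f x > 0"
  shows "C_k_on k (\<lambda>x. sqrt (f x)) U"
  using assms(2)
proof (induction k)
  case 0
  then show ?case by (auto intro: continuous_on_real_sqrt)
next
  case (Suc k)
  have IH: "C_k_on k (\<lambda>x. sqrt (f x)) U"
    by (rule Suc.IH[OF C_k_on_SucD[OF Suc.prems]])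
  have ne: "sqrt (f x) \<noteq> 0" if "x \<in> U" for x
    using pos[OF that] by simp
  show ?case
  proof (rule C_k_on_derivI[OF assms(1)])
    show "((\<lambda>x. sqrt (f x)) has_derivative
      (\<lambda>v. frechet_derivative f (at x) v * (inverse (sqrt (f x)) / 2))) (at x)" if "x \<in> U" for x
      by (rule has_derivative_real_sqrt[where g = f and x = x, OF pos[OF that]
            C_k_on_has_derivative[OF Suc.prems that]])
    show "C_k_on k (\<lambda>x. frechet_derivative f (at x) v * (inverse (sqrt (f x)) / 2)) U" for v
      unfolding divide_inverse
      by (intro C_k_on_mult C_k_on_inverse C_k_on_const C_k_on_frechet_derivative IH ne
          Suc.prems assms(1))
  qed
qed

lemma C_k_on_det:
  fixes A :: "'a::euclidean_space \<Rightarrow> real ^ 'n ^ 'n"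
  assumes "open U" "\<And>i j. C_k_on k (\<lambda>x. A x $ i $ j) U"
  shows "C_k_on k (\<lambda>x. det (A x)) U"
  unfolding det_def
  by (intro C_k_on_sum C_k_on_mult C_k_on_const C_k_on_prod assms)

text \<open>Cramer's rule reduces this to the smoothness of determinants.\<close>

lemma C_k_on_linear_system:
  fixes A :: "'a::euclidean_space \<Rightarrow> real ^ 'n ^ 'n"
  assumes "open U" "\<And>i j. C_k_on k (\<lambda>x. A x $ i $ j) U" "\<And>i. C_k_on k (\<lambda>x. b x $ i) U"
    and "\<And>x. x \<in> U \<Longrightarrow> det (A x) \<noteq> 0" "\<And>x. x \<in> U \<Longrightarrow> A x *v X x = b x"
  shows "C_k_on k X U"
proof -
  let ?Y = "\<lambda>x. \<chi> l. det (\<chi> i j. if j = l then b x $ i else A x $ i $ j) * inverse (det (A x))"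
  have comp: "C_k_on k (\<lambda>x. (\<chi> i j. if j = l then b x $ i else A x $ i $ j) $ i $ j) U" for l i j
    using assms(2)[of i j] assms(3)[of i] by (cases "j = l") simp_all
  have "C_k_on k ?Y U"
    by (intro C_k_on_vec_lambda C_k_on_mult C_k_on_inverse C_k_on_det comp assms)
  moreover have "?Y x = X x" if "x \<in> U" for x
    using cramer[OF assms(4)[OF that], of "X x" "b x"] assms(5)[OF that]
    by (simp add: divide_inverse)
  ultimately show ?thesis
    by (intro C_k_on_cong[of U ?Y X, OF assms(1)])
qed

text \<open>A single extension to one open set serves as the local extension at every point.\<close>

lemma smooth_map_on_openI:
  assumes "open U" "S \<subseteq> U" "\<And>k. C_k_on k g U" "\<And>x. x \<in> S \<Longrightarrow> g x = f x"
  shows "smooth_map_on f S"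
  unfolding smooth_map_on_def
proof (intro ballI exI conjI allI)
  show "x \<in> U" if "x \<in> S" for x
    using that assms(2) by blast
  show "g y = f y" if "y \<in> S \<inter> U" for y
    using that assms(4) by blast
qed (use assms in auto)

section \<open>Admissible configurations\<close>

text \<open>Pairing a convex combination equal to 0 with \<open>u\<close> gives nonpositive terms
  that add up to 0, so every weight off the hyperplane vanishes.\<close>

lemma zero_in_convex_hull_Int_hyperplane:
  fixes u :: "'a::euclidean_space"
  assumes "finite X" "0 \<in> convex hull X" and nonpos: "\<And>x. x \<in> X \<Longrightarrow> x \<bullet> u \<le> 0"
  shows "0 \<in> convex hull (X \<inter> {x. x \<bullet> u = 0})"
proof -
  obtain c where c: "\<And>x. x \<in> X \<Longrightarrow> 0 \<le> c x" "sum c X = 1" "(\<Sum>x\<in>X. c x *\<^sub>R x) = 0"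
    using assms(2) unfolding convex_hull_finite[OF assms(1)] by blast
  let ?Y = "X \<inter> {x. x \<bullet> u = 0}"
  have "(\<Sum>x\<in>X. - (c x * (x \<bullet> u))) = - ((\<Sum>x\<in>X. c x *\<^sub>R x) \<bullet> u)"
    by (simp add: inner_sum_left sum_negf)
  then have "(\<Sum>x\<in>X. - (c x * (x \<bullet> u))) = 0"
    using c(3) by simp
  moreover have "0 \<le> - (c x * (x \<bullet> u))" if "x \<in> X" for x
    using mult_nonneg_nonpos[OF c(1)[OF that] nonpos[OF that]] by simp
  ultimately have "\<forall>x\<in>X. - (c x * (x \<bullet> u)) = 0"
    using sum_nonneg_eq_0_iff[OF assms(1), of "\<lambda>x. - (c x * (x \<bullet> u))"] by blast
  then have zero: "c x = 0" if "x \<in> X - ?Y" for x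
    using that by auto
  have "sum c ?Y = 1" "(\<Sum>x\<in>?Y. c x *\<^sub>R x) = 0"
    using sum.mono_neutral_left[of X ?Y c] sum.mono_neutral_left[of X ?Y "\<lambda>x. c x *\<^sub>R x"]
      zero assms(1) c(2,3) by auto
  moreover have "finite ?Y"
    using assms(1) by simp
  ultimately show ?thesis
    using c(1) by (auto simp: convex_hull_finite)
qed

section \<open>Energy and moment along an orbit\<close>

definition energy :: "('n::finite \<Rightarrow> real ^ 'p::finite) \<Rightarrow> quat ^ 'n \<Rightarrow> real ^ 'p \<Rightarrow> real" where
  "energy \<Lambda> q T = (\<Sum>i\<in>UNIV. exp (2 * (\<Lambda> i \<bullet> T)) * (q $ i \<bullet> q $ i))"

text \<open>Half the gradient of \<^term>\<open>energy \<Lambda> q\<close>.\<close>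

definition moment :: "('n::finite \<Rightarrow> real ^ 'p::finite) \<Rightarrow> quat ^ 'n \<Rightarrow> real ^ 'p \<Rightarrow> real ^ 'p" where
  "moment \<Lambda> q T = (\<Sum>i\<in>UNIV. (exp (2 * (\<Lambda> i \<bullet> T)) * (q $ i \<bullet> q $ i)) *\<^sub>R \<Lambda> i)"

lemma exp_double: "exp (2 * x) = exp x * exp (x::real)"
  by (simp add: exp_add[symmetric])

lemma Phi_scaleR_Phi: "Phi \<Lambda> T' (r *\<^sub>R Phi \<Lambda> T q) = r *\<^sub>R Phi \<Lambda> (T + T') q"
  by (simp add: Phi_def vec_eq_iff inner_add_right exp_add mult_ac)

lemma energy_scaleR_Phi: "energy \<Lambda> (r *\<^sub>R Phi \<Lambda> T q) T' = r\<^sup>2 * energy \<Lambda> q (T + T')"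
  by (simp add: energy_def Phi_def sum_distrib_left inner_add_right distrib_left exp_add
      exp_double power2_eq_square mult_ac)

lemma moment_scaleR_Phi: "moment \<Lambda> (r *\<^sub>R Phi \<Lambda> T q) T' = r\<^sup>2 *\<^sub>R moment \<Lambda> q (T + T')"
  by (simp add: moment_def Phi_def scaleR_sum_right inner_add_right distrib_left exp_add
      exp_double power2_eq_square mult_ac)

lemma norm_Phi: "norm (Phi \<Lambda> T q) = sqrt (energy \<Lambda> q T)"
  by (simp add: norm_eq_sqrt_inner inner_vec_def Phi_def energy_def exp_double mult.assoc)

lemma moment_Phi: "(\<Sum>i\<in>UNIV. (norm (Phi \<Lambda> T q $ i))\<^sup>2 *\<^sub>R \<Lambda> i) = moment \<Lambda> q T"
  by (simp add: moment_def Phi_def dot_square_norm exp_double power2_eq_square mult_ac)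

lemma Z_set_iff: "q \<in> Z_set \<Lambda> \<longleftrightarrow> moment \<Lambda> q 0 = 0 \<and> energy \<Lambda> q 0 = 1"
  by (simp add: Z_set_def moment_def energy_def dot_square_norm)

lemma scaleR_Phi_in_S_set_iff:
  "r \<noteq> 0 \<Longrightarrow> r *\<^sub>R Phi \<Lambda> T q \<in> S_set \<Lambda> \<longleftrightarrow> q \<in> S_set \<Lambda>"
  by (simp add: S_set_def Phi_def)

text \<open>The squared norms of the nonzero coordinates are the weights of a convex combination
  equal to 0.\<close>

lemma Z_set_subset_S_set: "Z_set \<Lambda> \<subseteq> S_set \<Lambda>"
proof
  fix q assume q: "q \<in> Z_set \<Lambda>"
  let ?I = "{i. q $ i \<noteq> 0}"
  have "(\<Sum>i\<in>?I. (norm (q $ i))\<^sup>2 *\<^sub>R \<Lambda> i) \<in> convex hull (\<Lambda> ` ?I)"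
  proof (rule convex_sum)
    have "(\<Sum>i\<in>?I. (norm (q $ i))\<^sup>2) = (\<Sum>i\<in>UNIV. (norm (q $ i))\<^sup>2)"
      by (rule sum.mono_neutral_left) auto
    then show "(\<Sum>i\<in>?I. (norm (q $ i))\<^sup>2) = 1"
      using q by (simp add: Z_set_def)
  qed (auto intro: hull_inc)
  also have "(\<Sum>i\<in>?I. (norm (q $ i))\<^sup>2 *\<^sub>R \<Lambda> i) = (\<Sum>i\<in>UNIV. (norm (q $ i))\<^sup>2 *\<^sub>R \<Lambda> i)"
    by (rule sum.mono_neutral_left) auto
  finally show "q \<in> S_set \<Lambda>"
    using q by (simp add: Z_set_def S_set_def)
qed

text \<open>Nonzero coordinates stay nonzero nearby, so the support can only grow, and the convex
  hull grows with it.\<close>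

lemma open_S_set: "open (S_set (\<Lambda> :: 'n::finite \<Rightarrow> real ^ 'p::finite))"
  unfolding open_subopen[of "S_set \<Lambda>"]
proof
  fix q assume q: "q \<in> S_set \<Lambda>"
  let ?U = "\<Inter>i\<in>{i. q $ i \<noteq> 0}. {q' :: quat ^ 'n. q' $ i \<noteq> 0}"
  have "open ?U"
  proof (intro open_INT ballI)
    show "open {q' :: quat ^ 'n. q' $ i \<noteq> 0}" for i :: 'n
      by (rule open_Collect_neq[of "\<lambda>q'. q' $ i" "\<lambda>_. 0"]) (intro continuous_intros)+
  qed simp
  moreover have "?U \<subseteq> S_set \<Lambda>"
  proof
    fix q' assume "q' \<in> ?U"
    then have "\<Lambda> ` {i. q $ i \<noteq> 0} \<subseteq> \<Lambda> ` {i. q' $ i \<noteq> 0}"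
      by auto
    from hull_mono[OF this, of convex] show "q' \<in> S_set \<Lambda>"
      using q by (auto simp: S_set_def)
  qed
  ultimately show "\<exists>U. open U \<and> q \<in> U \<and> U \<subseteq> S_set \<Lambda>"
    by (intro exI[of _ ?U]) auto
qed

text \<open>Point and parameter are both functions of \<open>x\<close>. This covers a fixed point,
  independent variation of the two, and a parameter that depends on the point.\<close>

lemma has_derivative_weight:
  assumes "(f has_derivative f') (at x)" "(h has_derivative h') (at x)"
  shows "((\<lambda>x. exp (2 * (a \<bullet> h x)) * (f x $ i \<bullet> f x $ i)) has_derivative
    (\<lambda>v. exp (2 * (a \<bullet> h x)) * (2 * (f x $ i \<bullet> f' v $ i) + 2 * (a \<bullet> h' v) * (f x $ i \<bullet> f x $ i)))) (at x)"
proof -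
  have comp: "((\<lambda>x. f x $ i) has_derivative (\<lambda>v. f' v $ i)) (at x)"
    by (rule bounded_linear.has_derivative[OF bounded_linear_vec_nth assms(1)])
  have "((\<lambda>x. 2 * (a \<bullet> h x)) has_derivative (\<lambda>v. 2 * (a \<bullet> h' v))) (at x)"
    by (rule has_derivative_mult_right[OF
          bounded_linear.has_derivative[OF bounded_linear_inner_right assms(2)]])
  from has_derivative_eq_rhs[OF has_derivative_mult[OF has_derivative_exp[OF this]
        has_derivative_inner[OF comp comp]]]
  show ?thesis
    by (simp add: fun_eq_iff algebra_simps inner_commute)
qed

lemma has_derivative_moment:
  assumes "(f has_derivative f') (at x)" "(h has_derivative h') (at x)"
  shows "((\<lambda>x. moment \<Lambda> (f x) (h x)) has_derivative
    (\<lambda>v. \<Sum>i\<in>UNIV. (exp (2 * (\<Lambda> i \<bullet> h x)) *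
      (2 * (f x $ i \<bullet> f' v $ i) + 2 * (\<Lambda> i \<bullet> h' v) * (f x $ i \<bullet> f x $ i))) *\<^sub>R \<Lambda> i)) (at x)"
  unfolding moment_def
  by (intro has_derivative_sum has_derivative_scaleR_left has_derivative_weight assms)

lemma has_derivative_energy:
  "(energy \<Lambda> q has_derivative (\<lambda>v. 2 * (moment \<Lambda> q T \<bullet> v))) (at T)"
proof -
  have "((\<lambda>T. \<Sum>i\<in>UNIV. exp (2 * (\<Lambda> i \<bullet> T)) * (q $ i \<bullet> q $ i)) has_derivative
      (\<lambda>v. \<Sum>i\<in>UNIV. exp (2 * (\<Lambda> i \<bullet> T)) * (2 * (q $ i \<bullet> 0 $ i) + 2 * (\<Lambda> i \<bullet> v) * (q $ i \<bullet> q $ i))))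
      (at T)"
    by (intro has_derivative_sum
        has_derivative_weight[where f = "\<lambda>_. q" and f' = "\<lambda>_. 0" and h = "\<lambda>T. T" and h' = "\<lambda>v. v"]
        has_derivative_const has_derivative_ident)
  then show ?thesis
    by (simp add: energy_def[abs_def] moment_def inner_sum_left sum_distrib_left mult_ac)
qed

text \<open>Half the derivative of \<open>moment \<Lambda> q\<close> at \<open>T\<close>, hence a
  quarter of the Hessian of \<open>energy \<Lambda> q\<close>.\<close>

definition gram :: "('n::finite \<Rightarrow> real ^ 'p::finite) \<Rightarrow> quat ^ 'n \<Rightarrow> real ^ 'p \<Rightarrow> real ^ 'p ^ 'p" where
  "gram \<Lambda> q T = (\<chi> a b. \<Sum>i\<in>UNIV. exp (2 * (\<Lambda> i \<bullet> T)) * (q $ i \<bullet> q $ i) * \<Lambda> i $ a * \<Lambda> i $ b)"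

lemma gram_mult_vec:
  "gram \<Lambda> q T *v w = (\<Sum>i\<in>UNIV. (exp (2 * (\<Lambda> i \<bullet> T)) * (q $ i \<bullet> q $ i) * (\<Lambda> i \<bullet> w)) *\<^sub>R \<Lambda> i)"
proof -
  have "(\<Sum>b\<in>UNIV. (\<Sum>i\<in>UNIV. c i * \<Lambda> i $ a * \<Lambda> i $ b) * w $ b) =
      (\<Sum>i\<in>UNIV. c i * (\<Sum>b\<in>UNIV. \<Lambda> i $ b * w $ b) * \<Lambda> i $ a)" for c :: "_ \<Rightarrow> real" and a
    unfolding sum_distrib_left sum_distrib_right
    by (subst sum.swap) (simp add: mult_ac)
  then show ?thesis
    by (simp add: gram_def matrix_vector_mult_def vec_eq_iff inner_vec_def[of "\<Lambda> _" w])
qed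

section \<open>Strict convexity and coercivity of the energy\<close>

locale admissible =
  fixes \<Lambda> :: "'n::finite \<Rightarrow> real ^ 'p::finite"
  assumes admissible: "admissible_config \<Lambda>"
begin

text \<open>Otherwise the indices of \<open>I\<close> whose vectors lie in the hyperplane \<open>u\<^sup>\<bottom>\<close> would
  have 0 in their convex hull, and by Caratheodory \<open>p\<close> of them would suffice.\<close>

lemma exists_pos_inner:
  assumes "0 \<in> convex hull (\<Lambda> ` I)" "u \<noteq> 0"
  shows "\<exists>i\<in>I. \<Lambda> i \<bullet> u > 0"
proof (rule ccontr)
  assume "\<not> ?thesis"
  then have "0 \<in> convex hull (\<Lambda> ` I \<inter> {x. x \<bullet> u = 0})" (is "_ \<in> convex hull ?X")
    using assms(1) by (intro zero_in_convex_hull_Int_hyperplane) (auto simp: not_less)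
  then obtain S where S: "finite S" "S \<subseteq> ?X" "int (card S) \<le> aff_dim ?X + 1" "0 \<in> convex hull S"
    unfolding caratheodory_aff_dim[of ?X] by blast
  \<comment> \<open>The hyperplane has dimension \<open>p - 1\<close>, which absorbs the
    \<open>+ 1\<close> in Caratheodory's bound.\<close>
  have "aff_dim ?X \<le> aff_dim {x. u \<bullet> x = 0}"
    by (rule aff_dim_subset) (auto simp: inner_commute)
  then have card: "card S \<le> CARD('p)"
    using S(3) aff_dim_hyperplane[OF assms(2), of 0] by simp
  \<comment> \<open>Admissibility counts indices, not vectors, so one index is chosen for each
    vector of \<open>S\<close>.\<close>
  obtain J where "inj_on \<Lambda> J" "S = \<Lambda> ` J"
    using S(2) subset_image_inj[of S \<Lambda> I] by blast
  then show False
    using S(4) card admissible by (auto simp: admissible_config_def card_image)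
qed

lemma S_set_pos_inner:
  assumes "q \<in> S_set \<Lambda>" "u \<noteq> 0"
  obtains i where "q $ i \<noteq> 0" "\<Lambda> i \<bullet> u > 0"
  using exists_pos_inner[OF _ assms(2), of "{i. q $ i \<noteq> 0}"] assms(1) by (auto simp: S_set_def)

text \<open>Strict convexity of \<^term>\<open>energy \<Lambda> q\<close>, as strict monotonicity of its gradient.\<close>

lemma moment_inj:
  assumes "q \<in> S_set \<Lambda>" "moment \<Lambda> q T = moment \<Lambda> q T'"
  shows "T = T'"
proof (rule ccontr)
  assume "T \<noteq> T'"
  then obtain j where j: "q $ j \<noteq> 0" "\<Lambda> j \<bullet> (T - T') > 0"
    using S_set_pos_inner[OF assms(1), of "T - T'"] by auto
  \<comment> \<open>Since exp is increasing, the difference of exponentials and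
    \<open>\<Lambda> i \<bullet> (T - T')\<close> have the same sign, so no term is
    negative.\<close>
  define f where "f i = (exp (2 * (\<Lambda> i \<bullet> T)) - exp (2 * (\<Lambda> i \<bullet> T'))) * (q $ i \<bullet> q $ i) * (\<Lambda> i \<bullet> (T - T'))" for i
  have "0 < sum f UNIV"
  proof (rule sum_pos2[of UNIV j])
    show "0 < f j"
      using j by (auto simp: f_def inner_diff_right intro!: mult_pos_pos)
    show "0 \<le> f i" for i
    proof (cases "\<Lambda> i \<bullet> T \<le> \<Lambda> i \<bullet> T'")
      case True
      then show ?thesis
        by (auto simp: f_def inner_diff_right intro!: mult_nonpos_nonpos mult_nonpos_nonneg)
    next
      case False
      then show ?thesis
        by (auto simp: f_def inner_diff_right intro!: mult_nonneg_nonneg)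
    qed
  qed auto
  also have "sum f UNIV = (moment \<Lambda> q T - moment \<Lambda> q T') \<bullet> (T - T')"
    by (simp add: f_def[abs_def] moment_def inner_sum_left sum_subtractf[symmetric]
        scaleR_diff_left[symmetric] left_diff_distrib)
  finally show False
    using assms(2) by simp
qed

text \<open>The quadratic form of the matrix is a weighted sum of the squares of
  \<open>\<Lambda> i \<bullet> w\<close>, positive for nonzero \<open>w\<close> by
  \<open>S_set_pos_inner\<close>; hence the kernel is trivial.\<close>

lemma det_gram:
  assumes "q \<in> S_set \<Lambda>"
  shows "det (gram \<Lambda> q T) \<noteq> 0"
proof -
  have "w = 0" if w: "gram \<Lambda> q T *v w = 0" for w
  proof (rule ccontr)
    assume "w \<noteq> 0"
    then obtain j where j: "q $ j \<noteq> 0" "\<Lambda> j \<bullet> w > 0"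
      using S_set_pos_inner[OF assms] by blast
    have "0 < (\<Sum>i\<in>UNIV. exp (2 * (\<Lambda> i \<bullet> T)) * (q $ i \<bullet> q $ i) * (\<Lambda> i \<bullet> w)\<^sup>2)"
      by (rule sum_pos2[of UNIV j]) (use j in auto)
    also have "\<dots> = (gram \<Lambda> q T *v w) \<bullet> w"
      by (simp add: gram_mult_vec inner_sum_left power2_eq_square mult.assoc)
    finally show False
      using w by simp
  qed
  then have "\<exists>B. B ** gram \<Lambda> q T = mat 1"
    unfolding matrix_left_invertible_ker by blast
  then have "invertible (gram \<Lambda> q T)"
    by (simp add: invertible_left_inverse)
  then show ?thesis
    by (simp add: invertible_det_nz)
qed

lemma exists_min_energy:
  assumes "q \<in> S_set \<Lambda>"
  shows "\<exists>T. \<forall>T'. energy \<Lambda> q T \<le> energy \<Lambda> q T'"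
proof -
  \<comment> \<open>\<open>h\<close> is positively homogeneous, and its minimum over the unit sphere
    is positive by \<open>S_set_pos_inner\<close>. As \<open>exp (2 * x)\<close> dominates
    \<open>max 0 x\<close>, this minimum is a slope of linear growth for the energy.\<close>
  define h where "h u = (\<Sum>i\<in>UNIV. (q $ i \<bullet> q $ i) * max 0 (\<Lambda> i \<bullet> u))" for u
  have cont: "continuous_on UNIV h" "continuous_on A (energy \<Lambda> q)" for A
    unfolding h_def energy_def by (intro continuous_intros)+
  have "sphere (0 :: real ^ 'p) 1 \<noteq> {}"
    by simp
  then obtain u0 where u0: "norm u0 = 1" "\<And>u. norm u = 1 \<Longrightarrow> h u0 \<le> h u"
    using continuous_attains_inf[of "sphere 0 1" h] continuous_on_subset[OF cont(1)] by auto
  have "u0 \<noteq> 0"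
    using u0(1) by auto
  then obtain j where j: "q $ j \<noteq> 0" "\<Lambda> j \<bullet> u0 > 0"
    using S_set_pos_inner[OF assms] by blast
  have pos: "h u0 > 0"
    unfolding h_def by (rule sum_pos2[of UNIV j]) (use j in auto)
  have lower: "norm T * h u0 \<le> energy \<Lambda> q T" for T
  proof (cases "T = 0")
    case True
    then show ?thesis by (simp add: energy_def sum_nonneg)
  next
    case False
    have "norm T * h u0 \<le> norm T * h (T /\<^sub>R norm T)"
      using False by (intro mult_left_mono u0(2)) auto
    also have "\<dots> = (\<Sum>i\<in>UNIV. (q $ i \<bullet> q $ i) * (norm T * max 0 (\<Lambda> i \<bullet> (T /\<^sub>R norm T))))"
      by (simp add: h_def sum_distrib_left mult_ac)
    also have "\<dots> \<le> energy \<Lambda> q T"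
      unfolding energy_def
    proof (rule sum_mono)
      fix i
      have "norm T * max 0 (\<Lambda> i \<bullet> (T /\<^sub>R norm T)) = max 0 (\<Lambda> i \<bullet> T)"
        using False by (simp add: max_mult_distrib_left mult.assoc[symmetric])
      also have "\<dots> \<le> exp (2 * (\<Lambda> i \<bullet> T))"
        using exp_ge_add_one_self[of "2 * (\<Lambda> i \<bullet> T)"] exp_gt_zero[of "2 * (\<Lambda> i \<bullet> T)"]
        by linarith
      finally show "(q $ i \<bullet> q $ i) * (norm T * max 0 (\<Lambda> i \<bullet> (T /\<^sub>R norm T)))
          \<le> exp (2 * (\<Lambda> i \<bullet> T)) * (q $ i \<bullet> q $ i)"
        by (subst mult.commute) (rule mult_right_mono, auto)
    qed
    finally show ?thesis .
  qed
  \<comment> \<open>Outside the ball of radius \<open>R\<close> the linear lower bound is at least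
    the energy at 0, so a minimum over the ball is global.\<close>
  define R where "R = energy \<Lambda> q 0 / h u0"
  have "0 \<le> R"
    using lower[of 0] pos by (simp add: R_def)
  then obtain T where T: "T \<in> cball 0 R" "\<And>T'. T' \<in> cball 0 R \<Longrightarrow> energy \<Lambda> q T \<le> energy \<Lambda> q T'"
    using continuous_attains_inf[of "cball 0 R" "energy \<Lambda> q"] cont(2) by auto
  have "energy \<Lambda> q T \<le> energy \<Lambda> q T'" for T'
  proof (cases "T' \<in> cball 0 R")
    case False
    then have "energy \<Lambda> q 0 \<le> norm T' * h u0"
      using pos by (simp add: R_def field_simps)
    with lower[of T'] T(2)[of 0] \<open>0 \<le> R\<close> show ?thesis
      by auto
  qed (rule T(2))
  then show ?thesis by blast
qed

text \<open>The derivative vanishes at a minimum; it is evaluated in the direction of the moment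
  itself.\<close>

lemma moment_eq_0_if_min_energy:
  assumes "\<And>T'. energy \<Lambda> q T \<le> energy \<Lambda> q T'"
  shows "moment \<Lambda> q T = 0"
proof -
  have "(\<lambda>v. 2 * (moment \<Lambda> q T \<bullet> v)) = (\<lambda>v. 0)"
    by (rule differential_zero_maxmin[OF UNIV_I open_UNIV has_derivative_energy]) (use assms in auto)
  from fun_cong[OF this, of "moment \<Lambda> q T"] show ?thesis
    by simp
qed

lemma min_orbit:
  assumes "q0 \<in> S_set \<Lambda>"
  shows "\<exists>!q. is_arg_min norm (\<lambda>x. x \<in> Phi_orbit \<Lambda> q0) q"
    and "is_arg_min norm (\<lambda>x. x \<in> Phi_orbit \<Lambda> q0) q \<Longrightarrow>
      (\<Sum>i\<in>UNIV. (norm (q $ i))\<^sup>2 *\<^sub>R \<Lambda> i) = 0"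
proof -
  \<comment> \<open>The norm is the square root of the energy, so minimality on the orbit becomes
    minimality over the parameter.\<close>
  have iff: "is_arg_min norm (\<lambda>x. x \<in> Phi_orbit \<Lambda> q0) q \<longleftrightarrow>
      (\<exists>T. q = Phi \<Lambda> T q0 \<and> (\<forall>T'. energy \<Lambda> q0 T \<le> energy \<Lambda> q0 T'))" for q
    by (auto simp: is_arg_min_def Phi_orbit_def norm_Phi not_less)
  show "(\<Sum>i\<in>UNIV. (norm (q $ i))\<^sup>2 *\<^sub>R \<Lambda> i) = 0"
    if "is_arg_min norm (\<lambda>x. x \<in> Phi_orbit \<Lambda> q0) q"
    using that moment_eq_0_if_min_energy unfolding iff by (auto simp: moment_Phi)
  obtain T where T: "\<And>T'. energy \<Lambda> q0 T \<le> energy \<Lambda> q0 T'"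
    using exists_min_energy[OF assms] by blast
  show "\<exists>!q. is_arg_min norm (\<lambda>x. x \<in> Phi_orbit \<Lambda> q0) q"
    unfolding iff
  proof (intro ex1I[of _ "Phi \<Lambda> T q0"] exI[of _ T] conjI allI refl T)
    fix q assume "\<exists>T. q = Phi \<Lambda> T q0 \<and> (\<forall>T'. energy \<Lambda> q0 T \<le> energy \<Lambda> q0 T')"
    then obtain T2 where T2: "q = Phi \<Lambda> T2 q0" "\<And>T'. energy \<Lambda> q0 T2 \<le> energy \<Lambda> q0 T'"
      by blast
    have "T2 = T"
      by (rule moment_inj[OF assms])
        (simp add: moment_eq_0_if_min_energy[OF T] moment_eq_0_if_min_energy[OF T2(2)])
    then show "q = Phi \<Lambda> T q0"
      using T2(1) by simp
  qed
qed

section \<open>The critical parameter and its smooth dependence on the point\<close>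

definition \<tau> :: "quat ^ 'n \<Rightarrow> real ^ 'p" where
  "\<tau> q = (THE T. moment \<Lambda> q T = 0)"

lemma \<tau>_eqI:
  assumes "q \<in> S_set \<Lambda>" "moment \<Lambda> q T = 0"
  shows "\<tau> q = T"
  unfolding \<tau>_def
proof (rule the_equality)
  show "T' = T" if "moment \<Lambda> q T' = 0" for T'
    by (rule moment_inj[OF assms(1)]) (simp add: that assms(2))
qed (rule assms(2))

lemma moment_\<tau>:
  assumes "q \<in> S_set \<Lambda>"
  shows "moment \<Lambda> q (\<tau> q) = 0"
proof -
  obtain T where "\<And>T'. energy \<Lambda> q T \<le> energy \<Lambda> q T'"
    using exists_min_energy[OF assms] by blast
  then have "moment \<Lambda> q T = 0"
    by (rule moment_eq_0_if_min_energy)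
  with \<tau>_eqI[OF assms this] show ?thesis
    by simp
qed

text \<open>By invariance of domain the injective map \<open>(q, T) \<mapsto> (q, moment \<Lambda> q T)\<close> is a
  homeomorphism onto an open set, and \<^term>\<open>\<tau> q\<close> is read off from the preimage of \<open>(q, 0)\<close>.\<close>

lemma \<tau>_differentiable:
  assumes q: "q \<in> S_set \<Lambda>"
  shows "\<tau> differentiable (at q)"
proof -
  define F where "F = (\<lambda>z. (fst z, moment \<Lambda> (fst z) (snd z)))"
  define F' where "F' = (\<lambda>(v, w). (v, \<Sum>i\<in>UNIV. (exp (2 * (\<Lambda> i \<bullet> \<tau> q)) *
      (2 * (q $ i \<bullet> v $ i) + 2 * (\<Lambda> i \<bullet> w) * (q $ i \<bullet> q $ i))) *\<^sub>R \<Lambda> i))"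
  let ?D = "S_set \<Lambda> \<times> (UNIV :: (real ^ 'p) set)"
  have "continuous_on ?D F"
    unfolding F_def moment_def by (intro continuous_intros)
  moreover have "open ?D"
    by (intro open_Times open_S_set open_UNIV)
  moreover have "inj_on F ?D"
  proof (rule inj_onI)
    fix y z assume yz: "y \<in> ?D" "z \<in> ?D" "F y = F z"
    then have "fst y = fst z" "moment \<Lambda> (fst y) (snd y) = moment \<Lambda> (fst y) (snd z)"
      by (auto simp: F_def)
    moreover have "snd y = snd z"
      by (rule moment_inj[of "fst y"]) (use yz(1) calculation in auto)
    ultimately show "y = z"
      by (simp add: prod_eq_iff)
  qed
  ultimately obtain G where G: "homeomorphism ?D (F ` ?D) F G" and op: "open (F ` ?D)"
    using invariance_of_domain_homeomorphism[of ?D F] invariance_of_domain[of ?D F] by auto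
  have F\<tau>: "F (q', \<tau> q') = (q', 0)" if "q' \<in> S_set \<Lambda>" for q'
    using moment_\<tau>[OF that] by (simp add: F_def)
  have image: "(q', 0) \<in> F ` ?D" if "q' \<in> S_set \<Lambda>" for q'
    using F\<tau>[OF that] that by (intro image_eqI[of _ F "(q', \<tau> q')"]) auto
  have G\<tau>: "G (q', 0) = (q', \<tau> q')" if "q' \<in> S_set \<Lambda>" for q'
    using homeomorphism_apply1[OF G, of "(q', \<tau> q')"] that by (simp add: F\<tau>)
  have derF: "(F has_derivative F') (at (q, \<tau> q))"
  proof -
    have "(F has_derivative (\<lambda>z. (fst z, \<Sum>i\<in>UNIV. (exp (2 * (\<Lambda> i \<bullet> snd (q, \<tau> q))) *
      (2 * (fst (q, \<tau> q) $ i \<bullet> fst z $ i) + 2 * (\<Lambda> i \<bullet> snd z) * (fst (q, \<tau> q) $ i \<bullet> fst (q, \<tau> q) $ i))) *\<^sub>R \<Lambda> i)))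
      (at (q, \<tau> q))"
      unfolding F_def
      by (intro has_derivative_Pair has_derivative_moment has_derivative_fst has_derivative_snd
          has_derivative_ident)
    then show ?thesis
      by (simp add: F'_def case_prod_beta')
  qed
  have "linear F'"
    using has_derivative_linear[OF derF] .
  moreover have "inj F'"
  proof (rule linear_injective_0[OF \<open>linear F'\<close>, THEN iffD2], intro allI impI)
    fix z assume "F' z = 0"
    then have z: "fst z = 0" "(\<Sum>i\<in>UNIV. (exp (2 * (\<Lambda> i \<bullet> \<tau> q)) *
        (2 * (\<Lambda> i \<bullet> snd z) * (q $ i \<bullet> q $ i))) *\<^sub>R \<Lambda> i) = 0"
      by (auto simp: F'_def case_prod_beta' prod_eq_iff)
    \<comment> \<open>Once the first component of \<open>z\<close> is 0, the second component of
      \<open>F' z\<close> is twice the Gram matrix applied to \<open>snd z\<close>.\<close>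
    have "2 *\<^sub>R (gram \<Lambda> q (\<tau> q) *v snd z) = 0"
      unfolding z(2)[symmetric] by (simp add: gram_mult_vec scaleR_sum_right mult_ac)
    then have "gram \<Lambda> q (\<tau> q) *v snd z = gram \<Lambda> q (\<tau> q) *v 0"
      by simp
    then have "snd z = 0"
      \<comment> \<open>Cramer's rule serves as uniqueness here: \<open>snd z\<close> and 0 solve
        the same system.\<close>
      using cramer[OF det_gram[OF q, of "\<tau> q"], of "snd z" "gram \<Lambda> q (\<tau> q) *v 0"]
        cramer[OF det_gram[OF q, of "\<tau> q"], of 0 "gram \<Lambda> q (\<tau> q) *v 0"] by simp
    with z(1) show "z = 0"
      by (simp add: prod_eq_iff)
  qed
  \<comment> \<open>A left inverse of the derivative suffices, since \<open>G\<close> is already a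
    continuous right inverse of \<open>F\<close> on an open set.\<close>
  ultimately obtain G' where G': "linear G'" "G' \<circ> F' = id"
    using linear_injective_left_inverse by blast
  have "(G has_derivative G') (at (q, 0))"
  proof (rule has_derivative_inverse_basic[OF _ _ G'(2) _ op image[OF q]])
    show "(F has_derivative F') (at (G (q, 0)))"
      using derF by (simp add: G\<tau>[OF q])
    show "bounded_linear G'"
      using G'(1) by (simp add: linear_conv_bounded_linear)
    show "continuous (at (q, 0)) G"
      using homeomorphism_cont2[OF G] image[OF q] unfolding continuous_on_eq_continuous_at[OF op]
      by (rule bspec)
    show "F (G z) = z" if "z \<in> F ` ?D" for z
      using homeomorphism_apply2[OF G that] .
  qed
  then have derG: "(G has_derivative G') (at ((\<lambda>q'. (q', 0)) q))"
    by simp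
  have derP: "((\<lambda>q'. (q', 0)) has_derivative (\<lambda>v. (v, 0))) (at q)"
    by (intro has_derivative_Pair has_derivative_ident has_derivative_const)
  \<comment> \<open>On the slice with second component 0, the second component of \<open>G\<close>
    is \<open>\<tau>\<close>.\<close>
  have "((\<lambda>q'. snd (G (q', 0))) has_derivative (\<lambda>v. snd (G' (v, 0)))) (at q)"
    using has_derivative_snd[OF diff_chain_at[OF derP derG]] by (simp add: o_def)
  then have "(\<tau> has_derivative (\<lambda>v. snd (G' (v, 0)))) (at q)"
    by (rule has_derivative_transform_within_open[OF _ open_S_set q]) (simp add: G\<tau>)
  then show ?thesis
    by (rule differentiableI)
qed

text \<open>Implicit differentiation of \<open>moment \<Lambda> q (\<tau> q) = 0\<close>.\<close>

lemma gram_mult_frechet_derivative_\<tau>: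
  assumes q: "q \<in> S_set \<Lambda>"
  shows "gram \<Lambda> q (\<tau> q) *v frechet_derivative \<tau> (at q) v =
    - (\<Sum>i\<in>UNIV. (exp (2 * (\<Lambda> i \<bullet> \<tau> q)) * (q $ i \<bullet> v $ i)) *\<^sub>R \<Lambda> i)"
proof -
  let ?X = "frechet_derivative \<tau> (at q)"
  define D where "D = (\<lambda>v. \<Sum>i\<in>UNIV. (exp (2 * (\<Lambda> i \<bullet> \<tau> q)) *
      (2 * (q $ i \<bullet> v $ i) + 2 * (\<Lambda> i \<bullet> ?X v) * (q $ i \<bullet> q $ i))) *\<^sub>R \<Lambda> i)"
  have "((\<lambda>q. moment \<Lambda> q (\<tau> q)) has_derivative D) (at q)"
    unfolding D_def
    by (rule has_derivative_moment[OF has_derivative_ident])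
      (simp add: frechet_derivative_works[symmetric] \<tau>_differentiable[OF q])
  then have "((\<lambda>q. 0) has_derivative D) (at q)"
    by (rule has_derivative_transform_within_open[OF _ open_S_set q]) (simp add: moment_\<tau>)
  then have "D = (\<lambda>v. 0)"
    by (rule has_derivative_unique) (rule has_derivative_const)
  then have "(1/2) *\<^sub>R D v = 0"
    by simp
  also have "(1/2) *\<^sub>R D v = (\<Sum>i\<in>UNIV. (exp (2 * (\<Lambda> i \<bullet> \<tau> q)) * (q $ i \<bullet> v $ i)) *\<^sub>R \<Lambda> i)
      + gram \<Lambda> q (\<tau> q) *v ?X v"
    unfolding D_def gram_mult_vec scaleR_sum_right sum.distrib[symmetric]
      scaleR_add_left[symmetric] scaleR_scaleR
    by (intro sum.cong refl arg_cong2[where f = scaleR]) (simp add: algebra_simps)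
  finally show ?thesis
    by (simp add: eq_neg_iff_add_eq_0 add.commute)
qed

text \<open>Bootstrapping: the linear system for the derivative involves only \<open>q\<close> and
  \<open>\<tau> q\<close>, so order \<open>k\<close> for \<open>\<tau>\<close> gives order
  \<open>k\<close> for its derivative.\<close>

lemma C_k_on_\<tau>: "C_k_on k \<tau> (S_set \<Lambda>)"
proof (induction k)
  case 0
  show ?case
    using \<tau>_differentiable
    by (simp add: continuous_at_imp_continuous_on differentiable_imp_continuous_within)
next
  case (Suc k)
  let ?S = "S_set \<Lambda>"
  have comp: "C_k_on k (\<lambda>q. q $ i) ?S" for i
    by (rule C_k_on_vec_nth[OF open_S_set C_k_on_id[OF open_S_set]])
  have weight: "C_k_on k (\<lambda>q. exp (2 * (\<Lambda> i \<bullet> \<tau> q))) ?S" for i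
    by (intro C_k_on_exp C_k_on_mult C_k_on_const C_k_on_inner open_S_set Suc.IH)
  have "C_k_on k (\<lambda>q. frechet_derivative \<tau> (at q) v) ?S" for v
  proof (rule C_k_on_linear_system[OF open_S_set])
    show "det (gram \<Lambda> q (\<tau> q)) \<noteq> 0" if "q \<in> ?S" for q
      by (rule det_gram[OF that])
    show "gram \<Lambda> q (\<tau> q) *v frechet_derivative \<tau> (at q) v =
        (\<Sum>i\<in>UNIV. (exp (2 * (\<Lambda> i \<bullet> \<tau> q)) * (q $ i \<bullet> v $ i)) *\<^sub>R (- \<Lambda> i))" if "q \<in> ?S" for q
      using gram_mult_frechet_derivative_\<tau>[OF that] by (simp add: sum_negf)
    show "C_k_on k (\<lambda>q. gram \<Lambda> q (\<tau> q) $ a $ b) ?S" for a b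
      by (simp add: gram_def)
        (intro C_k_on_sum C_k_on_mult C_k_on_inner C_k_on_const weight comp open_S_set)
    show "C_k_on k (\<lambda>q. (\<Sum>i\<in>UNIV. (exp (2 * (\<Lambda> i \<bullet> \<tau> q)) * (q $ i \<bullet> v $ i)) *\<^sub>R (- \<Lambda> i)) $ a) ?S" for a
      by (intro C_k_on_vec_nth C_k_on_sum C_k_on_scaleR C_k_on_mult C_k_on_inner C_k_on_const
          weight comp open_S_set)
  qed
  then show ?case
    using \<tau>_differentiable by simp
qed

section \<open>The inverse map\<close>

definition inverse_map :: "quat ^ 'n \<Rightarrow> (quat ^ 'n) \<times> (real ^ 'p) \<times> real" where
  "inverse_map q =
    (inverse (sqrt (energy \<Lambda> q (\<tau> q))) *\<^sub>R Phi \<Lambda> (\<tau> q) q, - \<tau> q, sqrt (energy \<Lambda> q (\<tau> q)))"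

lemma energy_pos:
  assumes "q \<in> S_set \<Lambda>"
  shows "energy \<Lambda> q T > 0"
proof -
  \<comment> \<open>If all coordinates vanished, 0 would lie in the convex hull of the empty
    set.\<close>
  obtain j where "q $ j \<noteq> 0"
    using assms by (cases "\<exists>j. q $ j \<noteq> 0") (auto simp: S_set_def)
  then show ?thesis
    unfolding energy_def by (intro sum_pos2[of UNIV j]) auto
qed

lemma Phi_0 [simp]: "Phi \<Lambda> 0 q = q"
  by (simp add: Phi_def vec_eq_iff)

text \<open>At the critical parameter the moment is 0; dividing by the norm keeps it 0 and makes the
  energy 1.\<close>

lemma inverse_map_mem:
  assumes q: "q \<in> S_set \<Lambda>"
  shows "inverse_map q \<in> Z_set \<Lambda> \<times> UNIV \<times> {r. r > 0}"
  using energy_pos[OF q, of "\<tau> q"] moment_\<tau>[OF q]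
  by (simp add: inverse_map_def Z_set_iff moment_scaleR_Phi energy_scaleR_Phi power_inverse)

lemma inverse_map_right:
  assumes q: "q \<in> S_set \<Lambda>" and "inverse_map q = (z, T, r)"
  shows "r *\<^sub>R Phi \<Lambda> T z = q"
  using energy_pos[OF q, of "\<tau> q"] assms(2)
  by (auto simp: inverse_map_def Phi_scaleR_Phi)

text \<open>Moving \<open>r *\<^sub>R Phi \<Lambda> T z\<close> by \<open>- T\<close> leads back to
  \<open>r *\<^sub>R z\<close>, where the moment is 0 and the energy is \<open>r\<^sup>2\<close>.
  Hence the critical parameter is \<open>- T\<close>, which explains the sign in
  \<open>inverse_map\<close>.\<close>

lemma inverse_map_left:
  assumes z: "z \<in> Z_set \<Lambda>" and r: "r > 0"
  shows "inverse_map (r *\<^sub>R Phi \<Lambda> T z) = (z, T, r)"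
proof -
  let ?q = "r *\<^sub>R Phi \<Lambda> T z"
  have "?q \<in> S_set \<Lambda>"
    using z r Z_set_subset_S_set by (auto simp: scaleR_Phi_in_S_set_iff)
  moreover have "moment \<Lambda> ?q (- T) = 0"
    using z by (simp add: moment_scaleR_Phi Z_set_iff)
  ultimately have "\<tau> ?q = - T"
    by (rule \<tau>_eqI)
  moreover have "energy \<Lambda> ?q (- T) = r\<^sup>2"
    using z by (simp add: energy_scaleR_Phi Z_set_iff)
  ultimately show ?thesis
    using r by (simp add: inverse_map_def Phi_scaleR_Phi)
qed

lemma C_k_on_inverse_map: "C_k_on k inverse_map (S_set \<Lambda>)"
proof -
  let ?S = "S_set \<Lambda>"
  have comp: "C_k_on k (\<lambda>q. q $ i) ?S" for i
    by (rule C_k_on_vec_nth[OF open_S_set C_k_on_id[OF open_S_set]])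
  have root: "C_k_on k (\<lambda>q. sqrt (energy \<Lambda> q (\<tau> q))) ?S"
  proof (rule C_k_on_sqrt[OF open_S_set])
    show "C_k_on k (\<lambda>q. energy \<Lambda> q (\<tau> q)) ?S"
      unfolding energy_def
      by (intro C_k_on_sum C_k_on_mult C_k_on_exp C_k_on_inner C_k_on_const C_k_on_\<tau> comp open_S_set)
  qed (rule energy_pos)
  have nz: "sqrt (energy \<Lambda> q (\<tau> q)) \<noteq> 0" if "q \<in> ?S" for q
    using energy_pos[OF that, of "\<tau> q"] by simp
  have "C_k_on k (\<lambda>q. (-1) *\<^sub>R \<tau> q) ?S"
    by (intro C_k_on_scaleR C_k_on_const C_k_on_\<tau> open_S_set)
  then have neg: "C_k_on k (\<lambda>q. - \<tau> q) ?S"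
    by simp
  show ?thesis
    unfolding inverse_map_def[abs_def] Phi_def
    by (intro C_k_on_Pair C_k_on_vec_lambda C_k_on_scaleR C_k_on_inverse C_k_on_exp C_k_on_inner
        C_k_on_const C_k_on_\<tau> comp root neg nz open_S_set)
qed

lemma C_k_on_forward_map:
  "C_k_on k (\<lambda>(q, T, r). r *\<^sub>R Phi \<Lambda> T q :: quat ^ 'n) UNIV"
proof -
  have "C_k_on k (\<lambda>x :: (quat ^ 'n) \<times> (real ^ 'p) \<times> real. fst x $ i) UNIV" for i
    by (rule C_k_on_linear) (intro bounded_linear_compose[OF bounded_linear_vec_nth]
        bounded_linear_fst open_UNIV)+
  moreover have "C_k_on k (\<lambda>x :: (quat ^ 'n) \<times> (real ^ 'p) \<times> real. fst (snd x)) UNIV"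
    by (rule C_k_on_linear) (intro bounded_linear_compose[OF bounded_linear_fst]
        bounded_linear_snd open_UNIV)+
  moreover have "C_k_on k (\<lambda>x :: (quat ^ 'n) \<times> (real ^ 'p) \<times> real. snd (snd x)) UNIV"
    by (rule C_k_on_linear) (intro bounded_linear_compose[OF bounded_linear_snd]
        bounded_linear_snd open_UNIV)+
  ultimately show ?thesis
    unfolding Phi_def case_prod_beta'
    by (intro C_k_on_scaleR C_k_on_vec_lambda C_k_on_exp C_k_on_inner C_k_on_const open_UNIV)
qed

text \<open>The forward formula is smooth on the whole ambient space and
  \<open>S_set \<Lambda>\<close> is open, so neither direction needs charts of
  \<open>Z_set \<Lambda>\<close>.\<close>

lemma diffeomorphism:
  "diffeomorphism_on (\<lambda>(q, T, r). r *\<^sub>R Phi \<Lambda> T q)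
    (Z_set \<Lambda> \<times> (UNIV :: (real ^ 'p) set) \<times> {r :: real. r > 0}) (S_set \<Lambda>)"
  (is "diffeomorphism_on ?E ?A _")
proof -
  have left: "inverse_map (?E a) = a" if "a \<in> ?A" for a
    using that by (cases a) (auto simp: inverse_map_left)
  have right: "?E (inverse_map q) = q" if "q \<in> S_set \<Lambda>" for q
    using inverse_map_right[OF that] by (cases "inverse_map q") simp
  have into: "?E a \<in> S_set \<Lambda>" if "a \<in> ?A" for a
    using that subsetD[OF Z_set_subset_S_set, of _ \<Lambda>] by (auto simp: scaleR_Phi_in_S_set_iff)
  have bij: "bij_betw ?E ?A (S_set \<Lambda>)"
    by (intro bij_betw_byWitness[where f' = inverse_map] ballI image_subsetI
        inverse_map_mem into left right)
  have "inverse_map q = inv_into ?A ?E q" if "q \<in> S_set \<Lambda>" for q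
    using inv_into_f_eq[OF bij_betw_imp_inj_on[OF bij] inverse_map_mem[OF that] right[OF that]] by simp
  then have "smooth_map_on (inv_into ?A ?E) (S_set \<Lambda>)"
    by (rule smooth_map_on_openI[OF open_S_set subset_refl C_k_on_inverse_map])
  moreover have "smooth_map_on ?E ?A"
    by (rule smooth_map_on_openI[OF open_UNIV subset_UNIV C_k_on_forward_map refl])
  ultimately show ?thesis
    using bij by (simp add: diffeomorphism_on_def)
qed

end

theorem theorem4p5:
  fixes \<Lambda> :: "'n::finite \<Rightarrow> real ^ 'p::finite" and m :: nat
  assumes "m \<ge> 1" and "CARD('p) = 4 * m"
    and "admissible_config \<Lambda>"
    and "affine hull (range \<Lambda>) = UNIV"
  shows "(\<forall>q0 \<in> S_set \<Lambda>.
            (\<exists>!q. is_arg_min norm (\<lambda>x. x \<in> Phi_orbit \<Lambda> q0) q) \<and>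
            (\<forall>q. is_arg_min norm (\<lambda>x. x \<in> Phi_orbit \<Lambda> q0) q \<longrightarrow>
                 (\<Sum>i\<in>UNIV. (norm (q $ i))\<^sup>2 *\<^sub>R \<Lambda> i) = 0)) \<and>
         diffeomorphism_on (\<lambda>(q, T, r). r *\<^sub>R Phi \<Lambda> T q)
           (Z_set \<Lambda> \<times> (UNIV :: (real ^ 'p) set) \<times> {r :: real. r > 0}) (S_set \<Lambda>)"
proof -
  interpret admissible \<Lambda>
    by unfold_locales (rule assms(3))
  show ?thesis
    using min_orbit diffeomorphism by blast
qed

end
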